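(* Let $\mathbf{X}^{v_1},\ldots,\mathbf{X}^{v_q}\in k[\mathbf{X}]=k[X_1,\ldots,X_n]$ $(q\geq n)$ be monomials of the same degree generating a normal ideal. Then there exist $n$ among these monomials defining a Cremona transformation of $\mathbb{P}^{n-1}$.
   Context: Here $k$ is an arbitrary field, $n\geq 2$, and $X_1,\ldots,X_n$ are indeterminates over $k$. For $v=(a_1,\ldots,a_n)\in\mathbb{N}^n$ write $\mathbf{X}^v=X_1^{a_1}\cdots X_n^{a_n}$. An ideal $I$ of a ring $R$ is normal if all its powers are integrally closed in $R$. A set of $n$ monomials of the same degree in $k[X_1,\ldots,X_n]$ defines a Cremona transformation of $\mathbb{P}^{n-1}=\mathbb{P}^{n-1}_k$ if the rational map $\mathbb{P}^{n-1}\dashrightarrow\mathbb{P}^{n-1}$ having these monomials as coordinates is birational.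
   Formalization: It is additionally assumed that the exponent vectors v_1,…,v_q have rank n; without this the claim fails (X1², X1X2, X2² in three variables), and this rank condition is necessary for the conclusion. *)

theory Defs
  imports "HOL-Analysis.Analysis" "HOL-Library.Poly_Mapping"
begin

section \<open>Polynomials in the indeterminates $X_i$, $i$ ranging over a finite index type\<close>

text \<open>
  The polynomial ring $k[X_1,\ldots,X_n]$ is the monoid algebra of finitely supported coefficient
  functions on exponent vectors, with \<open>n = CARD('n)\<close>. Wherever the index type is required to
  carry a linear order, this is only because the library's instance of \<^class>\<open>idom\<close> for this
  algebra asks for one; no definition below refers to the order.
\<close>

type_synonym ('n, 'k) mpoly = "('n \<Rightarrow>\<^sub>0 nat) \<Rightarrow>\<^sub>0 'k"

definition xmonom :: "('n \<Rightarrow>\<^sub>0 nat) \<Rightarrow> ('n, 'k::comm_ring_1) mpoly" where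
  "xmonom a = Poly_Mapping.single a 1"

definition xvar :: "'n \<Rightarrow> ('n, 'k::comm_ring_1) mpoly" where
  "xvar i = xmonom (Poly_Mapping.single i 1)"

definition expdeg :: "('n::finite \<Rightarrow>\<^sub>0 nat) \<Rightarrow> nat" where
  "expdeg a = (\<Sum>i\<in>UNIV. Poly_Mapping.lookup a i)"

text \<open>The zero polynomial is homogeneous of every degree.\<close>

definition homogeneous :: "nat \<Rightarrow> ('n::finite, 'k::comm_ring_1) mpoly \<Rightarrow> bool" where
  "homogeneous d p \<longleftrightarrow> (\<forall>a\<in>Poly_Mapping.keys p. expdeg a = d)"

text \<open>\<open>psubst f p\<close> is $p(f_1,\ldots,f_n)$.\<close>

definition psubst ::
    "('n::finite \<Rightarrow> ('n, 'k::comm_ring_1) mpoly) \<Rightarrow> ('n, 'k) mpoly \<Rightarrow> ('n, 'k) mpoly" where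
  "psubst f p = (\<Sum>a\<in>Poly_Mapping.keys p.
     Poly_Mapping.single 0 (Poly_Mapping.lookup p a) * (\<Prod>i\<in>UNIV. f i ^ Poly_Mapping.lookup a i))"


section \<open>Ideals, integral closure, normality\<close>

text \<open>
  An ideal of a commutative ring \<open>R\<close> is an \<open>R\<close>-submodule of \<open>R\<close>, so the ideal generated by a set
  is its span for the ring multiplication as scalar multiplication.
\<close>

definition ideal_of :: "'a::comm_ring_1 set \<Rightarrow> 'a set" where
  "ideal_of S = module.span (*) S"

definition ideal_times :: "'a::comm_ring_1 set \<Rightarrow> 'a set \<Rightarrow> 'a set" where
  "ideal_times I J = ideal_of {x * y | x y. x \<in> I \<and> y \<in> J}"

primrec ideal_power :: "'a::comm_ring_1 set \<Rightarrow> nat \<Rightarrow> 'a set" where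
  "ideal_power I 0 = UNIV"
| "ideal_power I (Suc m) = ideal_times I (ideal_power I m)"

text \<open>
  \<open>r\<close> is integral over \<open>I\<close> if $r^m + a_1 r^{m-1} + \cdots + a_m = 0$ for some $m \geq 1$ and
  some $a_i \in I^i$.
\<close>

definition integral_over_ideal :: "'a::comm_ring_1 set \<Rightarrow> 'a \<Rightarrow> bool" where
  "integral_over_ideal I r \<longleftrightarrow>
     (\<exists>m\<ge>1. \<exists>a. (\<forall>i\<in>{1..m}. a i \<in> ideal_power I i) \<and> r ^ m + (\<Sum>i=1..m. a i * r ^ (m - i)) = 0)"

definition integrally_closed_ideal :: "'a::comm_ring_1 set \<Rightarrow> bool" where
  "integrally_closed_ideal I \<longleftrightarrow> (\<forall>r. integral_over_ideal I r \<longrightarrow> r \<in> I)"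

definition normal_ideal :: "'a::comm_ring_1 set \<Rightarrow> bool" where
  "normal_ideal I \<longleftrightarrow> module.subspace (*) I \<and> (\<forall>m\<ge>1. integrally_closed_ideal (ideal_power I m))"


section \<open>Rational maps of projective space to itself\<close>

text \<open>
  A rational map $P^{n-1} \dashrightarrow P^{n-1}$ over \<open>k\<close> is represented by a tuple of
  polynomials, not all zero, that are homogeneous of the same degree. Two tuples represent the same
  rational map iff they are proportional over the function field, which is \<open>same_rational_map\<close>.
  Working with polynomial identities, and not with \<open>k\<close>-rational points, makes this correct
  over an arbitrary (possibly finite) field.
\<close>

definition rational_map :: "('n::finite \<Rightarrow> ('n, 'k::comm_ring_1) mpoly) \<Rightarrow> bool" where
  "rational_map f \<longleftrightarrow> (\<exists>i. f i \<noteq> 0) \<and> (\<exists>d. \<forall>i. homogeneous d (f i))"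

definition same_rational_map ::
    "('n::finite \<Rightarrow> ('n, 'k::comm_ring_1) mpoly) \<Rightarrow> ('n \<Rightarrow> ('n, 'k) mpoly) \<Rightarrow> bool" where
  "same_rational_map f g \<longleftrightarrow> (\<forall>i j. f i * g j = f j * g i)"

text \<open>
  The composite \<open>g \<circ> f\<close>; it is defined as a rational map iff the substituted tuple is
  again a \<^const>\<open>rational_map\<close>, that is, does not vanish identically.
\<close>

definition rational_comp ::
    "('n::finite \<Rightarrow> ('n, 'k::comm_ring_1) mpoly) \<Rightarrow> ('n \<Rightarrow> ('n, 'k) mpoly) \<Rightarrow> 'n \<Rightarrow> ('n, 'k) mpoly" where
  "rational_comp g f = (\<lambda>i. psubst f (g i))"

text \<open>The identity of projective space is represented by the tuple \<^const>\<open>xvar\<close> of indeterminates.\<close>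

definition birational :: "('n::finite \<Rightarrow> ('n, 'k::comm_ring_1) mpoly) \<Rightarrow> bool" where
  "birational f \<longleftrightarrow> rational_map f \<and>
     (\<exists>g. rational_map g \<and>
          rational_map (rational_comp g f) \<and> same_rational_map (rational_comp g f) xvar \<and>
          rational_map (rational_comp f g) \<and> same_rational_map (rational_comp f g) xvar)"

text \<open>
  A family of \<open>n\<close> monomials of the same degree, given by exponent vectors indexed by \<open>'n\<close>, defines
  a Cremona transformation over the field \<open>'k\<close> (passed as a type argument).
\<close>

definition defines_cremona :: "'k::field itself \<Rightarrow> ('n::finite \<Rightarrow> ('n \<Rightarrow>\<^sub>0 nat)) \<Rightarrow> bool" where
  "defines_cremona _ w \<longleftrightarrow>
     (\<exists>d. \<forall>i. expdeg (w i) = d) \<and> birational (\<lambda>i. xmonom (w i) :: ('n, 'k) mpoly)"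


section \<open>The log-matrix\<close>

text \<open>
  The columns of the log-matrix of a family of monomials are their exponent vectors; its rank is
  the dimension of the space they span.
\<close>

definition logvec :: "('n::finite \<Rightarrow>\<^sub>0 nat) \<Rightarrow> real ^ 'n" where
  "logvec a = (\<chi> i. real (Poly_Mapping.lookup a i))"

definition log_rank :: "('n::finite \<Rightarrow>\<^sub>0 nat) set \<Rightarrow> nat" where
  "log_rank A = dim (logvec ` A)"

end

theory Submission
  imports Defs
begin

text \<open>
  The proof looks for a basis of a lattice among the exponent vectors.

  Let \<open>L\<close> be the lattice of integer vectors whose coordinate sum is divisible by \<open>d\<close>. If exponent
  vectors of degree \<open>d\<close> form a basis of \<open>L\<close>, then the differences of coordinate vectors, which lie in
  \<open>L\<close>, are integer combinations of them, and the coefficients, made nonnegative by a common shift, are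
  the exponents of an inverse monomial map (\<open>cremona_of_lattice_basis\<close>).

  Normality says that the given exponent vectors generate, as a semigroup, everything they can: if a
  multiple of a point of \<open>L\<close> is a sum of exponent vectors, then the point itself is one. Indeed the
  corresponding monomial is integral over a power of the ideal, hence lies in that power, and has the
  smallest degree occurring there (\<open>normal_nat_span_saturated\<close>). As the rank is full, it follows that
  the exponent vectors generate the group \<open>L\<close> (\<open>normal_span_eq\<close>) and form a Hilbert basis of the cone
  they span.

  A pointed Hilbert basis always contains a basis of the lattice that it generates, a theorem of Gerards
  and Sebo (\<open>hilbert_basis_contains_lattice_basis\<close>). It is proved by induction along a flag of faces:
  a lattice basis found on a facet is completed by a vector at minimal lattice distance from that
  facet, and the Hilbert property forces such a vector to be among the generators.
\<close>

section \<open>Sums of a prescribed number of elements\<close>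

primrec fold_sumset :: "'a::comm_monoid_add set \<Rightarrow> nat \<Rightarrow> 'a set" where
  "fold_sumset A 0 = {0}"
| "fold_sumset A (Suc m) = {a + b | a b. a \<in> A \<and> b \<in> fold_sumset A m}"

definition nat_span :: "'a::comm_monoid_add set \<Rightarrow> 'a set" where
  "nat_span A = (\<Union>m. fold_sumset A m)"

lemma fold_sumset_add:
  assumes "a \<in> fold_sumset A m" "b \<in> fold_sumset A k"
  shows "a + b \<in> fold_sumset A (m + k)"
  using assms(1)
proof (induction m arbitrary: a)
  case 0
  then show ?case using assms(2) by simp
next
  case (Suc m)
  then obtain x y where xy: "a = x + y" "x \<in> A" "y \<in> fold_sumset A m" by auto
  then have "y + b \<in> fold_sumset A (m + k)" using Suc.IH by blast
  with xy show ?case by (auto simp: add.assoc)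
qed

lemma fold_sumset_split:
  assumes "x \<in> fold_sumset A (m + k)"
  shows "\<exists>a\<in>fold_sumset A m. \<exists>b\<in>fold_sumset A k. x = a + b"
  using assms
proof (induction m arbitrary: x)
  case 0
  then show ?case by simp
next
  case (Suc m)
  then obtain s y where sy: "x = s + y" "s \<in> A" "y \<in> fold_sumset A (m + k)" by auto
  obtain a b where ab: "a \<in> fold_sumset A m" "b \<in> fold_sumset A k" "y = a + b"
    using Suc.IH[OF sy(3)] by blast
  have "s + a \<in> fold_sumset A (Suc m)" using sy ab by auto
  moreover have "x = (s + a) + b" using sy ab by (simp add: add.assoc)
  ultimately show ?case using ab(2) by blast
qed

lemma fold_sumset_mult:
  "x \<in> fold_sumset A (N * m) \<Longrightarrow> x \<in> fold_sumset (fold_sumset A m) N"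
proof (induction N arbitrary: x)
  case (Suc N)
  then have "x \<in> fold_sumset A (m + N * m)" by simp
  then show ?case using fold_sumset_split[of x A m "N * m"] Suc.IH by auto
qed simp

lemma nat_span_zero: "0 \<in> nat_span A"
  unfolding nat_span_def by (rule UN_I[of 0]) auto

lemma nat_span_base: "a \<in> A \<Longrightarrow> a \<in> nat_span A"
  unfolding nat_span_def by (rule UN_I[of "Suc 0"]) auto

lemma nat_span_add: "a \<in> nat_span A \<Longrightarrow> b \<in> nat_span A \<Longrightarrow> a + b \<in> nat_span A"
  unfolding nat_span_def using fold_sumset_add by blast

lemma nat_span_induct [consumes 1, case_names zero step]:
  assumes "x \<in> nat_span A" "P 0"
    and "\<And>a y. a \<in> A \<Longrightarrow> y \<in> nat_span A \<Longrightarrow> P y \<Longrightarrow> P (a + y)"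
  shows "P x"
proof -
  have "x \<in> fold_sumset A m \<Longrightarrow> P x" for m x
  proof (induction m arbitrary: x)
    case (Suc m)
    then obtain a y where "x = a + y" "a \<in> A" "y \<in> fold_sumset A m" by auto
    then show ?case using assms(3)[of a y] Suc.IH[of y] unfolding nat_span_def by auto
  qed (use assms(2) in simp)
  then show ?thesis using assms(1) unfolding nat_span_def by blast
qed

lemma nat_span_mono:
  assumes "A \<subseteq> B" "x \<in> nat_span A"
  shows "x \<in> nat_span B"
  using assms(2,1) by (induction x rule: nat_span_induct) (auto intro: nat_span_zero nat_span_add nat_span_base)


section \<open>Integer combinations and integer functionals\<close>

interpretation zmod: module "(*s) :: int \<Rightarrow> int ^ 'n \<Rightarrow> int ^ 'n"
  by unfold_locales (simp_all add: vec_eq_iff algebra_simps)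

lemma nat_span_scale:
  fixes x :: "int ^ 'n"
  assumes "x \<in> nat_span S" "k \<ge> 0"
  shows "k *s x \<in> nat_span S"
  using assms(2)
proof (induction k rule: int_ge_induct)
  case base
  then show ?case by (simp add: nat_span_zero)
next
  case (step k)
  then show ?case using assms(1) by (simp add: zmod.scale_left_distrib nat_span_add)
qed

lemma nat_span_subset_span:
  fixes x :: "int ^ 'n"
  shows "x \<in> nat_span S \<Longrightarrow> x \<in> zmod.span S"
  by (induction x rule: nat_span_induct)
    (auto intro: zmod.span_zero zmod.span_add zmod.span_base)

text \<open>
  The negative part of an integer combination can be cancelled by adding natural multiples of the
  generators. This is how lattice points are moved into the cone below.
\<close>

lemma span_plus_nat_span:
  fixes z :: "int ^ 'n"
  assumes "z \<in> zmod.span S"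
  shows "\<exists>f\<in>nat_span S. z + f \<in> nat_span S"
  using assms
proof (induction rule: zmod.span_induct_alt)
  case base
  show ?case by (rule bexI[of _ 0]) (auto simp: nat_span_zero)
next
  case (step c x y)
  then obtain f where f: "f \<in> nat_span S" "y + f \<in> nat_span S" by blast
  have x: "x \<in> nat_span S" using step nat_span_base by blast
  show ?case
  proof (cases "c \<ge> 0")
    case True
    then have "c *s x + (y + f) \<in> nat_span S" using f x nat_span_scale nat_span_add by blast
    then show ?thesis using f by (metis add.assoc)
  next
    case False
    have "(- c) *s x + f \<in> nat_span S"
      using False f x by (intro nat_span_add nat_span_scale) auto
    moreover have "c *s x + y + ((- c) *s x + f) = y + f" by simp
    ultimately show ?thesis using f by metis
  qed
qed

definition dotp :: "int ^ 'n \<Rightarrow> int ^ 'n \<Rightarrow> int" where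
  "dotp c x = (\<Sum>i\<in>UNIV. c $ i * x $ i)"

lemma dotp_simps [simp]:
  "dotp c 0 = 0"
  "dotp c (x + y) = dotp c x + dotp c y"
  "dotp c (x - y) = dotp c x - dotp c y"
  "dotp c (k *s x) = k * dotp c x"
  "dotp (a - b) x = dotp a x - dotp b x"
  "dotp (k *s a) x = k * dotp a x"
  by (simp_all add: dotp_def algebra_simps sum.distrib sum_subtractf sum_distrib_left)

lemma dotp_axis [simp]: "dotp (axis i 1) x = x $ i"
  by (simp add: dotp_def axis_def if_distrib if_distribR cong: if_cong)

lemma dotp_zero_on_span:
  assumes "x \<in> zmod.span S" "\<And>s. s \<in> S \<Longrightarrow> dotp c s = 0"
  shows "dotp c x = 0"
  using assms(1) by (induction rule: zmod.span_induct_alt) (auto simp: assms(2))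

lemma dotp_nonneg_on_nat_span:
  assumes "x \<in> nat_span S" "\<And>s. s \<in> S \<Longrightarrow> dotp c s \<ge> 0"
  shows "dotp c x \<ge> 0"
  using assms(1) by (induction rule: nat_span_induct) (auto simp: assms(2))

text \<open>
  Linear duality over the rational numbers, stated with denominators cleared so that everything stays
  integral. When a generator \<open>a\<close> is added to \<open>F\<close> and some functional \<open>c\<close> kills \<open>F\<close> but not \<open>a\<close>,
  the point \<open>y\<close> is first projected along \<open>a\<close> onto the kernel of \<open>c\<close>, and a functional that separates
  the projection is corrected by a multiple of \<open>c\<close> so that it kills \<open>a\<close> too.
\<close>

lemma multiple_in_span_or_separated:
  fixes y :: "int ^ 'n"
  assumes "finite F"
  shows "(\<exists>K\<ge>1. K *s y \<in> zmod.span F) \<or> (\<exists>c. (\<forall>s\<in>F. dotp c s = 0) \<and> dotp c y \<noteq> 0)"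
  using assms
proof (induction F arbitrary: y rule: finite_induct)
  case empty
  show ?case
  proof (cases "y = 0")
    case True
    then show ?thesis by (intro disjI1 exI[of _ 1]) simp
  next
    case False
    then obtain i where "y $ i \<noteq> 0" by (auto simp: vec_eq_iff)
    then show ?thesis by (intro disjI2 exI[of _ "axis i 1"]) simp
  qed
next
  case (insert a F)
  have pos: "\<exists>K\<ge>1. K *s z \<in> zmod.span T" if "k *s z \<in> zmod.span T" "k \<noteq> 0" for k z T
  proof (cases "k \<ge> 1")
    case False
    then have "(- k) *s z \<in> zmod.span T" "- k \<ge> 1"
      using that zmod.span_neg[OF that(1)] by (auto simp: zmod.scale_minus_left)
    then show ?thesis by blast
  qed (use that in blast)
  have mono: "z \<in> zmod.span F \<Longrightarrow> z \<in> zmod.span (insert a F)" for z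
    using zmod.span_mono[of F "insert a F"] by blast
  have a_in: "a \<in> zmod.span (insert a F)" by (simp add: zmod.span_base)
  show ?case
  proof (cases "\<exists>c. (\<forall>s\<in>F. dotp c s = 0) \<and> dotp c a \<noteq> 0")
    case False
    then obtain K where K: "K \<ge> 1" "K *s a \<in> zmod.span F" using insert.IH by blast
    from insert.IH[of y] show ?thesis
    proof
      assume "\<exists>K\<ge>1. K *s y \<in> zmod.span F"
      then show ?thesis using mono by blast
    next
      assume "\<exists>c. (\<forall>s\<in>F. dotp c s = 0) \<and> dotp c y \<noteq> 0"
      then show ?thesis using False by (metis insert_iff)
    qed
  next
    case True
    then obtain c where c: "\<forall>s\<in>F. dotp c s = 0" "dotp c a \<noteq> 0" by blast
    let ?y = "dotp c a *s y - dotp c y *s a"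
    from insert.IH[of ?y] show ?thesis
    proof
      assume "\<exists>K\<ge>1. K *s ?y \<in> zmod.span F"
      then obtain K where K: "K \<ge> 1" "K *s ?y \<in> zmod.span F" by blast
      have "K *s ?y + (K * dotp c y) *s a \<in> zmod.span (insert a F)"
        using K mono a_in zmod.span_add zmod.span_scale by blast
      moreover have "K *s ?y + (K * dotp c y) *s a = (K * dotp c a) *s y"
        by (simp add: zmod.scale_right_diff_distrib)
      ultimately show ?thesis using pos[of "K * dotp c a" y] K c by auto
    next
      assume "\<exists>b. (\<forall>s\<in>F. dotp b s = 0) \<and> dotp b ?y \<noteq> 0"
      then obtain b where b: "\<forall>s\<in>F. dotp b s = 0" "dotp b ?y \<noteq> 0" by blast
      show ?thesis
        by (intro disjI2 exI[of _ "dotp c a *s b - dotp b a *s c"])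
           (use b c in \<open>auto simp: algebra_simps\<close>)
    qed
  qed
qed

text \<open>
  The functional is one whose zero set \<open>F\<close> in \<open>S\<close> is as large as possible. If \<open>F\<close> did not span the
  kernel up to multiples, some functional \<open>b\<close> would kill \<open>F\<close> without being proportional to \<open>c\<close> on
  the span of \<open>S\<close>. Tilting \<open>c\<close> towards \<open>b\<close> until a further element of \<open>S\<close> is reached gives a
  nonzero functional that is still nonnegative on \<open>S\<close> and has a larger zero set.
\<close>

lemma exists_supporting_facet:
  fixes S :: "(int ^ 'n) set"
  assumes "finite S" and c0: "\<forall>s\<in>S. dotp c0 s \<ge> 0" "\<exists>s\<in>S. dotp c0 s \<noteq> 0"
  obtains c where "\<forall>s\<in>S. dotp c s \<ge> 0" "\<exists>s\<in>S. dotp c s \<noteq> 0"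
    "\<And>y. y \<in> zmod.span S \<Longrightarrow> dotp c y = 0 \<Longrightarrow>
       \<exists>K\<ge>1. K *s y \<in> zmod.span {s \<in> S. dotp c s = 0}"
proof -
  define P where "P c \<longleftrightarrow> (\<forall>s\<in>S. dotp c s \<ge> 0) \<and> (\<exists>s\<in>S. dotp c s \<noteq> 0)" for c
  define F where "F c = {s \<in> S. dotp c s = 0}" for c
  have "card (F c) \<le> card S" for c
    unfolding F_def using assms(1) by (auto intro: card_mono)
  then have "\<exists>c. P c \<and> (\<forall>c'. P c' \<longrightarrow> card (F c') \<le> card (F c))"
    using c0 ex_has_greatest_nat[of P c0 "\<lambda>c. card (F c)" "Suc (card S)"]
    by (force simp: P_def less_Suc_eq_le)
  then obtain c where c: "P c" and max: "\<And>c'. P c' \<Longrightarrow> card (F c') \<le> card (F c)" by blast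
  have "\<exists>K\<ge>1. K *s y \<in> zmod.span (F c)" if y: "y \<in> zmod.span S" "dotp c y = 0" for y
  proof (rule ccontr)
    assume neg: "\<not> ?thesis"
    have fin: "finite (F c)" using assms(1) by (simp add: F_def)
    from multiple_in_span_or_separated[OF fin, of y] neg
    obtain b where b: "\<forall>s\<in>F c. dotp b s = 0" "dotp b y \<noteq> 0" by blast
    define D where "D = S - F c"
    have D: "finite D" "D \<noteq> {}" using c assms(1) by (auto simp: D_def F_def P_def)
    have Dpos: "dotp c s > 0" if "s \<in> D" for s
      using that c by (auto simp: D_def F_def P_def order_less_le)
    \<comment> \<open>The element of \<open>S\<close> that the tilted hyperplane meets first; cross-multiplied, the minimality
      of its ratio says that \<open>t\<close> is nonnegative on \<open>S\<close>.\<close>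
    obtain s0 where s0: "s0 \<in> D"
      and least: "\<And>s. s \<in> D \<Longrightarrow> real_of_int (dotp b s0) / dotp c s0 \<le> real_of_int (dotp b s) / dotp c s"
      using ex_is_arg_min_if_finite[OF D, of "\<lambda>s. real_of_int (dotp b s) / dotp c s"]
      by (auto simp: is_arg_min_linorder)
    define t where "t = dotp c s0 *s b - dotp b s0 *s c"
    have t: "dotp t s = dotp c s0 * dotp b s - dotp b s0 * dotp c s" for s
      by (simp add: t_def)
    have tF: "dotp t s = 0" if "s \<in> F c" for s
      using that b(1) by (simp add: t F_def)
    have tD: "dotp t s \<ge> 0" if "s \<in> D" for s
    proof -
      have "real_of_int (dotp b s0) * dotp c s \<le> real_of_int (dotp b s) * dotp c s0"
        using least[OF that] Dpos[OF that] Dpos[OF s0] by (simp add: field_simps)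
      then have "real_of_int (dotp b s0 * dotp c s) \<le> real_of_int (dotp b s * dotp c s0)" by simp
      then show ?thesis unfolding t of_int_le_iff by (simp add: mult.commute)
    qed
    have "dotp t y \<noteq> 0" using b(2) y(2) Dpos[OF s0] by (simp add: t)
    then have "\<exists>s\<in>S. dotp t s \<noteq> 0" using dotp_zero_on_span[OF y(1), of t] by blast
    moreover have "\<forall>s\<in>S. dotp t s \<ge> 0" using tF tD by (force simp: D_def)
    ultimately have "P t" by (simp add: P_def)
    have less: "F c \<subset> F t"
    proof
      show "F c \<subseteq> F t" using tF by (auto simp: F_def)
      have "s0 \<in> F t" "s0 \<notin> F c" using s0 by (auto simp: t F_def D_def)
      then show "F c \<noteq> F t" by blast
    qed
    have "finite (F t)" using assms(1) by (simp add: F_def)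
    then have "card (F c) < card (F t)" using less by (rule psubset_card_mono)
    then show False using max[OF \<open>P t\<close>] by simp
  qed
  then show thesis using that[of c] c unfolding P_def F_def by blast
qed

definition to_real :: "int ^ 'n \<Rightarrow> real ^ 'n" where
  "to_real x = (\<chi> i. real_of_int (x $ i))"

lemma inner_to_real: "inner (to_real c) (to_real x) = real_of_int (dotp c x)"
  by (simp add: to_real_def dotp_def inner_vec_def)

text \<open>
  The second premise says that \<open>x\<close> lies in the cone over \<open>S\<close>; the multiplier \<open>K\<close> replaces rational
  coefficients.
\<close>

definition is_hilbert_basis :: "(int ^ 'n) set \<Rightarrow> bool" where
  "is_hilbert_basis S \<longleftrightarrow> (\<forall>x\<in>zmod.span S. \<forall>K\<ge>1. K *s x \<in> nat_span S \<longrightarrow> x \<in> nat_span S)"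

lemma nat_span_face:
  assumes "x \<in> nat_span S" "\<forall>s\<in>S. dotp c s \<ge> 0" "dotp c x = 0"
  shows "x \<in> nat_span {s \<in> S. dotp c s = 0}"
  using assms(1,3)
proof (induction rule: nat_span_induct)
  case (step a y)
  have "dotp c y \<ge> 0" using dotp_nonneg_on_nat_span step.hyps assms(2) by blast
  then have "dotp c a = 0" "dotp c y = 0" using step.hyps step.prems assms(2) by (fastforce, fastforce)
  then show ?case using step by (auto intro: nat_span_add nat_span_base)
qed (rule nat_span_zero)

lemma is_hilbert_basis_face:
  assumes "is_hilbert_basis S" "\<forall>s\<in>S. dotp c s \<ge> 0"
  shows "is_hilbert_basis {s \<in> S. dotp c s = 0}"
  unfolding is_hilbert_basis_def
proof (intro ballI allI impI)
  let ?F = "{s \<in> S. dotp c s = 0}"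
  fix x K assume x: "x \<in> zmod.span ?F" and K: "(1::int) \<le> K" "K *s x \<in> nat_span ?F"
  have "x \<in> zmod.span S" using x zmod.span_mono[of ?F S] by blast
  moreover have "K *s x \<in> nat_span S" using K nat_span_mono[of ?F S] by blast
  ultimately have "x \<in> nat_span S" using assms(1) K by (auto simp: is_hilbert_basis_def)
  moreover have "dotp c x = 0" using dotp_zero_on_span[OF x] by blast
  ultimately show "x \<in> nat_span ?F" using nat_span_face assms(2) by blast
qed

lemma least_positive_value_attained:
  assumes "x \<in> nat_span S" "dotp c x = g" "g > 0"
    and "\<And>s. s \<in> S \<Longrightarrow> dotp c s = 0 \<or> dotp c s \<ge> g"
  obtains h where "h \<in> S" "dotp c h = g"
proof -
  have "dotp c x = 0 \<or> dotp c x > g" if none: "\<forall>h\<in>S. dotp c h \<noteq> g"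
    using assms(1)
  proof (induction rule: nat_span_induct)
    case (step a y)
    then show ?case using none assms(3) assms(4)[of a] by fastforce
  qed simp
  then show thesis using assms(2,3) that by auto
qed

text \<open>
  The part of \<open>S\<close> on a facet of its cone is again a Hilbert basis, hence by induction contains a
  lattice basis \<open>W\<close> of what it generates. One more vector \<open>h\<close> completes \<open>W\<close> to a lattice basis, provided
  it lies at the smallest positive height \<open>g\<close> above the facet that a lattice point can have. Such an
  \<open>h\<close> exists in \<open>S\<close>: a lattice point of height \<open>g\<close> can be pushed along the facet into the cone, where
  it is a natural combination of elements of \<open>S\<close>; as each summand has height zero or at least \<open>g\<close>, one
  of them has height exactly \<open>g\<close>. The functional \<open>e\<close> guarantees that the cone is pointed, so that a facet exists.
  Independence is recorded over the real numbers to allow counting by dimension.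
\<close>

lemma hilbert_basis_contains_lattice_basis:
  fixes S :: "(int ^ 'n) set"
  assumes "finite S" "is_hilbert_basis S" "\<forall>s\<in>S. dotp e s > 0"
  shows "\<exists>W\<subseteq>S. zmod.span W = zmod.span S \<and> inj_on to_real W \<and> independent (to_real ` W)"
  using assms
proof (induction S rule: finite_psubset_induct)
  case (psubset S)
  show ?case
  proof (cases "S = {}")
    case True
    then show ?thesis by (intro exI[of _ "{}"]) (auto simp: independent_empty)
  next
    case False
    then have "\<forall>s\<in>S. dotp e s \<ge> 0" "\<exists>s\<in>S. dotp e s \<noteq> 0"
      using psubset.prems(2) by (force, force)
    with psubset.hyps(1) obtain c where c: "\<forall>s\<in>S. dotp c s \<ge> 0" "\<exists>s\<in>S. dotp c s \<noteq> 0"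
      and mult: "\<And>y. y \<in> zmod.span S \<Longrightarrow> dotp c y = 0 \<Longrightarrow>
        \<exists>K\<ge>1. K *s y \<in> zmod.span {s \<in> S. dotp c s = 0}"
      by (rule exists_supporting_facet) blast
    define F where "F = {s \<in> S. dotp c s = 0}"
    have FS: "F \<subset> S" "F \<subseteq> S" using c(2) by (auto simp: F_def)
    have F0: "\<And>s. s \<in> F \<Longrightarrow> dotp c s = 0" by (simp add: F_def)
    have hF: "is_hilbert_basis F" unfolding F_def using is_hilbert_basis_face psubset.prems(1) c(1) by blast
    obtain W where W: "W \<subseteq> F" "zmod.span W = zmod.span F" "inj_on to_real W" "independent (to_real ` W)"
      using psubset.IH[OF FS(1) hF] FS(2) psubset.prems(2) by blast
    obtain h0 where h0: "h0 \<in> S" "dotp c h0 > 0" using c by force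
    \<comment> \<open>Pushing along the facet: after multiplication by \<open>N\<close>, the point \<open>x\<close> is a nonnegative multiple
      of \<open>h0\<close> plus a combination of facet elements, whose negative part \<open>f\<close> absorbs.\<close>
    have lift: "\<exists>f\<in>nat_span F. x + f \<in> nat_span S"
      if x: "x \<in> zmod.span S" "dotp c x \<ge> 0" for x
    proof -
      let ?z = "dotp c h0 *s x - dotp c x *s h0"
      have "?z \<in> zmod.span S"
        using x(1) h0(1) zmod.span_diff zmod.span_scale zmod.span_base by blast
      moreover have "dotp c ?z = 0" by simp
      ultimately obtain K where K: "K \<ge> 1" "K *s ?z \<in> zmod.span F"
        using mult F_def by blast
      obtain f where f: "f \<in> nat_span F" "K *s ?z + f \<in> nat_span F"
        using span_plus_nat_span[OF K(2)] by blast
      have fS: "f \<in> nat_span S" "K *s ?z + f \<in> nat_span S"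
        using f nat_span_mono[OF FS(2)] by blast+
      define N where "N = K * dotp c h0"
      have N: "N \<ge> 1" unfolding N_def using K(1) h0(2)
        by (metis int_one_le_iff_zero_less mult_pos_pos)
      have "(K * dotp c x) *s h0 + ((K *s ?z + f) + (N - 1) *s f) \<in> nat_span S"
      proof -
        have "(K * dotp c x) *s h0 \<in> nat_span S"
          using K(1) x(2) h0(1) by (intro nat_span_scale nat_span_base) auto
        moreover have "(N - 1) *s f \<in> nat_span S" using N fS(1) by (intro nat_span_scale) auto
        ultimately show ?thesis using nat_span_add fS(2) by blast
      qed
      moreover have "(K * dotp c x) *s h0 + ((K *s ?z + f) + (N - 1) *s f) = N *s (x + f)"
        by (simp add: N_def vec_eq_iff algebra_simps)
      moreover have "x + f \<in> zmod.span S"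
        using x(1) nat_span_subset_span[OF fS(1)] zmod.span_add by blast
      ultimately have "x + f \<in> nat_span S"
        using psubset.prems(1) N unfolding is_hilbert_basis_def by metis
      then show ?thesis using f(1) by blast
    qed
    \<comment> \<open>The facet elements generate all lattice points at height zero, not only multiples of them.\<close>
    have ker: "y \<in> zmod.span F" if y: "y \<in> zmod.span S" "dotp c y = 0" for y
    proof -
      obtain f where f: "f \<in> nat_span F" "y + f \<in> nat_span S"
        using lift[OF y(1)] y(2) by auto
      have fF: "f \<in> zmod.span F" using nat_span_subset_span f(1) by blast
      have "dotp c (y + f) = 0" using y(2) dotp_zero_on_span[OF fF F0] by simp
      then have "y + f \<in> nat_span F" using nat_span_face f(2) c(1) F_def by blast
      then have "y + f - f \<in> zmod.span F" using nat_span_subset_span fF zmod.span_diff by blast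
      then show ?thesis by simp
    qed
    define pos where "pos n \<longleftrightarrow> n > 0 \<and> (\<exists>x\<in>zmod.span S. dotp c x = int n)" for n
    define g where "g = (LEAST n. pos n)"
    have "pos (nat (dotp c h0))" using h0 by (auto simp: pos_def intro: zmod.span_base)
    then have g: "pos g" and g_least: "\<And>n. pos n \<Longrightarrow> g \<le> n"
      unfolding g_def by (auto intro: LeastI Least_le)
    obtain x where x: "x \<in> zmod.span S" "dotp c x = int g" "g > 0" using g by (auto simp: pos_def)
    have least: "dotp c y = 0 \<or> dotp c y \<ge> int g" if "y \<in> zmod.span S" "dotp c y \<ge> 0" for y
      using g_least[of "nat (dotp c y)"] that unfolding pos_def
      by (cases "dotp c y = 0") (use that in fastforce)+
    obtain f where f: "f \<in> nat_span F" "x + f \<in> nat_span S" using lift[of x] x by auto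
    have "dotp c f = 0" using dotp_zero_on_span[OF nat_span_subset_span[OF f(1)] F0] by simp
    then have "dotp c (x + f) = int g" using x(2) by simp
    moreover have "dotp c s = 0 \<or> dotp c s \<ge> int g" if "s \<in> S" for s
      using least[OF zmod.span_base[OF that]] c(1) that by blast
    ultimately obtain h where h: "h \<in> S" "dotp c h = int g"
      using least_positive_value_attained[OF f(2)] x(3) by (metis of_nat_0_less_iff)
    have "s \<in> zmod.span (insert h W)" if "s \<in> zmod.span S" for s
    proof -
      let ?r = "s - (dotp c s div int g) *s h"
      have r: "?r \<in> zmod.span S"
        using that h(1) zmod.span_diff zmod.span_scale zmod.span_base by blast
      have "dotp c ?r = dotp c s mod int g" by (simp add: h(2) minus_div_mult_eq_mod)
      moreover have "dotp c s mod int g \<ge> 0" "dotp c s mod int g < int g" using x(3) by simp_all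
      ultimately have "dotp c ?r = 0" using least[OF r] by linarith
      then have "?r \<in> zmod.span W" using ker r W(2) by blast
      then show ?thesis using zmod.span_breakdown_eq by blast
    qed
    moreover have "zmod.span (insert h W) \<subseteq> zmod.span S"
      using W(1) FS h(1) by (intro zmod.span_mono) blast
    ultimately have "zmod.span (insert h W) = zmod.span S" by blast
    moreover have hspan: "to_real h \<notin> span (to_real ` W)"
    proof
      assume "to_real h \<in> span (to_real ` W)"
      moreover have "span (to_real ` W) \<subseteq> {u. inner (to_real c) u = 0}"
        using W(1) F0 by (intro span_minimal subspace_hyperplane) (auto simp: inner_to_real)
      ultimately have "inner (to_real c) (to_real h) = 0" by blast
      then show False using h(2) x(3) by (simp add: inner_to_real)
    qed
    have "to_real h \<notin> to_real ` W" using hspan span_base by metis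
    then have "inj_on to_real (insert h W)" using W(3) by (auto simp: inj_on_insert)
    moreover have "independent (to_real ` insert h W)"
      using W(4) hspan by (simp add: independent_insertI)
    moreover have "insert h W \<subseteq> S" using W(1) h(1) FS(2) by blast
    ultimately show ?thesis by blast
  qed
qed

section \<open>Monomials in powers of a monomial ideal\<close>

interpretation ideal: module "(*) :: 'a::comm_ring_1 \<Rightarrow> 'a \<Rightarrow> 'a"
  by unfold_locales (simp_all add: algebra_simps)

lemma subspace_ideal_power: "ideal.subspace (ideal_power I m)"
  by (cases m) (simp_all add: ideal_times_def ideal_of_def ideal.subspace_UNIV)

lemma mult_in_ideal_power_Suc:
  "x \<in> I \<Longrightarrow> y \<in> ideal_power I m \<Longrightarrow> x * y \<in> ideal_power I (Suc m)"
  unfolding ideal_power.simps ideal_times_def ideal_of_def by (rule ideal.span_base) blast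

text \<open>
  The equation of integral dependence is \<open>r ^ N - r ^ N = 0\<close>, where the second power of \<open>r\<close> is read
  as the constant coefficient.
\<close>

lemma integral_if_power_mem:
  assumes "N \<ge> 1" "r ^ N \<in> ideal_power I N"
  shows "integral_over_ideal I r"
proof -
  define a where "a i = (if i = N then - (r ^ N) else 0)" for i
  have "a i \<in> ideal_power I i" for i
    using assms(2) ideal.subspace_neg[OF subspace_ideal_power]
      ideal.subspace_0[OF subspace_ideal_power] by (auto simp: a_def)
  moreover have "(\<Sum>i=1..N. a i * r ^ (N - i)) = (\<Sum>i=1..N. if i = N then - (r ^ N) else 0)"
    by (intro sum.cong) (auto simp: a_def)
  then have "(\<Sum>i=1..N. a i * r ^ (N - i)) = - (r ^ N)"
    using assms(1) by simp
  ultimately show ?thesis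
    unfolding integral_over_ideal_def using assms(1) by (intro exI[of _ N] conjI exI[of _ a]) auto
qed

lemma xmonom_mult: "xmonom a * xmonom b = (xmonom (a + b) :: ('n, 'k::comm_ring_1) mpoly)"
  by (simp add: xmonom_def mult_single)

lemma xmonom_0: "xmonom 0 = (1 :: ('n, 'k::comm_ring_1) mpoly)"
  by (simp add: xmonom_def)

lemma xmonom_sum: "xmonom (sum f A) = (\<Prod>i\<in>A. xmonom (f i) :: ('n, 'k::comm_ring_1) mpoly)"
  by (induction A rule: infinite_finite_induct) (simp_all add: xmonom_0 flip: xmonom_mult)

lemma xmonom_power: "xmonom a ^ k = (xmonom (\<Sum>_<k. a) :: ('n, 'k::comm_ring_1) mpoly)"
  by (simp add: xmonom_sum)

lemma keys_xmonom [simp]: "Poly_Mapping.keys (xmonom a :: ('n, 'k::field) mpoly) = {a}"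
  by (simp add: xmonom_def)

lemma xmonom_mem_ideal_power:
  assumes "xmonom ` A \<subseteq> I" "a \<in> fold_sumset A m"
  shows "(xmonom a :: ('n, 'k::comm_ring_1) mpoly) \<in> ideal_power I m"
  using assms(2)
proof (induction m arbitrary: a)
  case (Suc m)
  then obtain x y where "a = x + y" "x \<in> A" "y \<in> fold_sumset A m" by auto
  then show ?case
    using assms(1) Suc.IH mult_in_ideal_power_Suc[of "xmonom x" I "xmonom y" m]
    by (auto simp: xmonom_mult)
qed simp

text \<open>
  Membership in an ideal generated by monomials is decided monomial by monomial. Taking this as the
  definition makes the exponents of elements of ideal powers accessible.
\<close>

definition monomial_ideal :: "('n \<Rightarrow>\<^sub>0 nat) set \<Rightarrow> ('n, 'k::comm_ring_1) mpoly set" where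
  "monomial_ideal A = {p. \<forall>t\<in>Poly_Mapping.keys p. \<exists>a\<in>A. \<exists>u. t = a + u}"

lemma monomial_ideal_mult:
  assumes "p \<in> monomial_ideal A" "q \<in> monomial_ideal B"
  shows "p * q \<in> monomial_ideal {a + b | a b. a \<in> A \<and> b \<in> B}"
  unfolding monomial_ideal_def mem_Collect_eq
proof
  fix t assume "t \<in> Poly_Mapping.keys (p * q)"
  then obtain x y where xy: "t = x + y" "x \<in> Poly_Mapping.keys p" "y \<in> Poly_Mapping.keys q"
    using keys_mult by fast
  then obtain a u b w where "a \<in> A" "x = a + u" "b \<in> B" "y = b + w"
    using assms unfolding monomial_ideal_def by blast
  moreover from this have "t = (a + b) + (u + w)" using xy by (simp add: algebra_simps)
  ultimately show "\<exists>c\<in>{a + b | a b. a \<in> A \<and> b \<in> B}. \<exists>u. t = c + u" by blast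
qed

lemma subspace_monomial_ideal:
  "ideal.subspace (monomial_ideal A :: ('n, 'k::comm_ring_1) mpoly set)"
proof (rule ideal.subspaceI)
  fix c x :: "('n, 'k::comm_ring_1) mpoly" assume x: "x \<in> monomial_ideal A"
  have "c \<in> monomial_ideal {0}" by (auto simp: monomial_ideal_def)
  then have "c * x \<in> monomial_ideal {a + b | a b. a \<in> {0} \<and> b \<in> A}"
    using x by (rule monomial_ideal_mult)
  then show "c * x \<in> monomial_ideal A" by simp
next
  fix x y :: "('n, 'k::comm_ring_1) mpoly"
  assume "x \<in> monomial_ideal A" "y \<in> monomial_ideal A"
  then show "x + y \<in> monomial_ideal A"
    using keys_add[of x y] unfolding monomial_ideal_def by blast
qed (simp add: monomial_ideal_def)

lemma ideal_power_subset_monomial_ideal: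
  "ideal_power (ideal_of (xmonom ` A :: ('n, 'k::field) mpoly set)) m \<subseteq> monomial_ideal (fold_sumset A m)"
proof (induction m)
  case 0
  show ?case by (auto simp: monomial_ideal_def)
next
  case (Suc m)
  let ?I = "ideal_of (xmonom ` A :: ('n, 'k) mpoly set)"
  have "?I \<subseteq> monomial_ideal A"
    unfolding ideal_of_def
    by (rule ideal.span_minimal[OF _ subspace_monomial_ideal])
       (auto simp: monomial_ideal_def intro!: exI[of _ 0])
  then have "{x * y | x y. x \<in> ?I \<and> y \<in> ideal_power ?I m} \<subseteq> monomial_ideal (fold_sumset A (Suc m))"
    using Suc.IH monomial_ideal_mult by fastforce
  then show ?case
    unfolding ideal_power.simps ideal_times_def ideal_of_def[of "{x * y | x y. _ x y}"]
    by (rule ideal.span_minimal[OF _ subspace_monomial_ideal])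
qed

lemma expdeg_0 [simp]: "expdeg 0 = 0"
  by (simp add: expdeg_def)

lemma expdeg_add [simp]: "expdeg (a + b) = expdeg a + expdeg b"
  by (simp add: expdeg_def lookup_add sum.distrib)

lemma expdeg_sum [simp]: "expdeg (sum f A) = (\<Sum>i\<in>A. expdeg (f i))"
  by (induction A rule: infinite_finite_induct) auto

lemma expdeg_eq_0 [simp]: "expdeg a = 0 \<longleftrightarrow> a = 0"
  by (auto simp: expdeg_def intro: poly_mapping_eqI)

lemma expdeg_fold_sumset:
  "\<forall>a\<in>A. expdeg a = d \<Longrightarrow> x \<in> fold_sumset A m \<Longrightarrow> expdeg x = m * d"
  by (induction m arbitrary: x) auto

text \<open>
  The monomial with exponent \<open>x\<close> has its \<open>N\<close>-th power in the \<open>N\<close>-th power of \<open>I\<^sup>m\<close>, so it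
  is integral over \<open>I\<^sup>m\<close> and, by normality, divisible by a product of \<open>m\<close> generators. Both have
  the same degree because all generators do, so they are equal.
\<close>

lemma normal_monomial_ideal_saturated:
  assumes normal: "normal_ideal (ideal_of (xmonom ` A :: ('n::finite, 'k::field) mpoly set))"
    and deg: "\<forall>a\<in>A. expdeg a = d"
    and N: "N \<ge> 1" "(\<Sum>_<N. x) \<in> fold_sumset A (N * m)"
  shows "x \<in> fold_sumset A m"
proof -
  let ?I = "ideal_of (xmonom ` A :: ('n, 'k) mpoly set)"
  have "N * expdeg x = N * m * d" using expdeg_fold_sumset[OF deg N(2)] by simp
  then have dx: "expdeg x = m * d" using N(1) by simp
  show ?thesis
  proof (cases "m = 0")
    case True
    then show ?thesis using dx by simp
  next
    case False
    have sub: "xmonom ` A \<subseteq> ?I" unfolding ideal_of_def by (rule ideal.span_superset)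
    have "(xmonom x :: ('n, 'k) mpoly) ^ N \<in> ideal_power (ideal_power ?I m) N"
      unfolding xmonom_power
      by (rule xmonom_mem_ideal_power[OF _ fold_sumset_mult[OF N(2)]])
         (use xmonom_mem_ideal_power[OF sub] in blast)
    then have "(xmonom x :: ('n, 'k) mpoly) \<in> ideal_power ?I m"
      using normal False N(1) integral_if_power_mem
      unfolding normal_ideal_def integrally_closed_ideal_def by (metis One_nat_def Suc_leI neq0_conv)
    then have "(xmonom x :: ('n, 'k) mpoly) \<in> monomial_ideal (fold_sumset A m)"
      using ideal_power_subset_monomial_ideal by blast
    then obtain a u where au: "a \<in> fold_sumset A m" "x = a + u"
      unfolding monomial_ideal_def by auto
    then have "expdeg u = 0" using expdeg_fold_sumset[OF deg au(1)] dx by simp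
    then show ?thesis using au by simp
  qed
qed

section \<open>Exponent vectors as integer vectors\<close>

definition int_vec :: "('n::finite \<Rightarrow>\<^sub>0 nat) \<Rightarrow> int ^ 'n" where
  "int_vec a = (\<chi> i. int (Poly_Mapping.lookup a i))"

lemma int_vec_0 [simp]: "int_vec 0 = 0"
  by (simp add: int_vec_def vec_eq_iff)

lemma int_vec_add [simp]: "int_vec (a + b) = int_vec a + int_vec b"
  by (simp add: int_vec_def vec_eq_iff lookup_add)

lemma int_vec_sum [simp]: "int_vec (sum f A) = (\<Sum>i\<in>A. int_vec (f i))"
  by (induction A rule: infinite_finite_induct) auto

lemma int_vec_eq_iff [simp]: "int_vec a = int_vec b \<longleftrightarrow> a = b"
  by (auto simp: int_vec_def vec_eq_iff intro: poly_mapping_eqI)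

lemma int_vec_single: "int_vec (Poly_Mapping.single i 1) = axis i 1"
  by (auto simp: int_vec_def vec_eq_iff lookup_single axis_def when_def)

lemma sum_const_vec: "(\<Sum>_<k. x) = int k *s (x :: int ^ 'n)"
  by (induction k) (simp_all add: zmod.scale_left_distrib algebra_simps)

lemma nonneg_is_int_vec:
  fixes x :: "int ^ 'n::finite"
  assumes "\<And>i. x $ i \<ge> 0"
  obtains a where "x = int_vec a"
proof
  have "Poly_Mapping.lookup (Abs_poly_mapping (\<lambda>i. nat (x $ i))) = (\<lambda>i. nat (x $ i))"
    by (rule lookup_Abs_poly_mapping) simp
  then show "x = int_vec (Abs_poly_mapping (\<lambda>i. nat (x $ i)))"
    using assms by (simp add: int_vec_def vec_eq_iff)
qed

lemma fold_sumset_int_vec: "fold_sumset (int_vec ` A) m = int_vec ` fold_sumset A m"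
proof (induction m)
  case (Suc m)
  show ?case unfolding fold_sumset.simps Suc.IH
    by (auto simp: image_iff) (metis int_vec_add)+
qed simp

abbreviation vdeg :: "int ^ 'n \<Rightarrow> int" where
  "vdeg \<equiv> dotp 1"

lemma vdeg_int_vec: "vdeg (int_vec a) = int (expdeg a)"
  by (simp add: dotp_def int_vec_def expdeg_def)

lemma vdeg_axis [simp]: "vdeg (axis k 1) = 1"
  by (simp add: dotp_def axis_def)

lemma to_real_int_vec: "to_real (int_vec a) = logvec a"
  by (simp add: to_real_def int_vec_def logvec_def)

lemma dotp_sum: "dotp c (sum f A) = (\<Sum>i\<in>A. dotp c (f i))"
  by (induction A rule: infinite_finite_induct) auto

lemma to_real_simps [simp]:
  "to_real 0 = 0" "to_real (x + y) = to_real x + to_real y"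
  "to_real (k *s x) = real_of_int k *\<^sub>R to_real x"
  by (simp_all add: to_real_def vec_eq_iff)

lemma to_real_sum: "to_real (sum f A) = (\<Sum>i\<in>A. to_real (f i))"
  by (induction A rule: infinite_finite_induct) auto

lemma to_real_span: "x \<in> zmod.span W \<Longrightarrow> to_real x \<in> span (to_real ` W)"
  by (induction rule: zmod.span_induct_alt) (auto intro!: span_zero span_add span_scale intro: span_base)

section \<open>The lattice generated by the exponent vectors\<close>

text \<open>
  A point whose positive multiple is a sum of exponent vectors has nonnegative coordinates, so it is
  itself an exponent. Its degree is \<open>d * m\<close> for some \<open>m\<close>, and comparing degrees shows that the number
  of summands is \<open>K * m\<close>, as the saturation property of the ideal requires.
\<close>

lemma normal_nat_span_saturated:
  assumes normal: "normal_ideal (ideal_of (xmonom ` A :: ('n::finite, 'k::field) mpoly set))"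
    and deg: "\<forall>a\<in>A. expdeg a = d" and d: "d > 0"
    and x: "int d dvd vdeg x" "K \<ge> 1" "K *s x \<in> nat_span (int_vec ` A)"
  shows "x \<in> nat_span (int_vec ` A)"
proof -
  obtain p y where y: "y \<in> fold_sumset A p" "K *s x = int_vec y"
    using x(3) unfolding nat_span_def fold_sumset_int_vec by blast
  have "x $ i \<ge> 0" for i
  proof -
    have "K * x $ i = int (Poly_Mapping.lookup y i)"
      using y(2) by (simp add: vec_eq_iff int_vec_def)
    then have "K * x $ i \<ge> 0" by simp
    then show ?thesis using x(2) by (simp add: zero_le_mult_iff)
  qed
  then obtain a where a: "x = int_vec a" by (rule nonneg_is_int_vec)
  have "d dvd expdeg a" using x(1) by (simp add: a vdeg_int_vec)
  then obtain m where m: "expdeg a = d * m" by blast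
  define N where "N = nat K"
  have N: "K = int N" "N \<ge> 1" using x(2) by (auto simp: N_def)
  have "int_vec (\<Sum>_<N. a) = int_vec y" using y(2) by (simp only: int_vec_sum sum_const_vec N a)
  then have ya: "(\<Sum>_<N. a) = y" by (simp only: int_vec_eq_iff)
  then have "N * (d * m) = p * d" using expdeg_fold_sumset[OF deg y(1)] m by auto
  then have "p = N * m" using d by simp
  then have "a \<in> fold_sumset A m"
    using normal_monomial_ideal_saturated[OF normal deg N(2)] y(1) ya by blast
  then show ?thesis unfolding nat_span_def fold_sumset_int_vec a by blast
qed

text \<open>
  Otherwise duality gives an integer functional that vanishes on all the exponent vectors but not on
  \<open>x\<close>. It would vanish on their real span, which is the whole space.
\<close>

lemma full_rank_multiple_in_span:
  assumes "finite A" "log_rank A = CARD('n)"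
  shows "\<exists>K\<ge>1. K *s (x :: int ^ 'n::finite) \<in> zmod.span (int_vec ` A)"
proof (rule ccontr)
  assume "\<not> ?thesis"
  then obtain c where c: "\<forall>s\<in>int_vec ` A. dotp c s = 0" "dotp c x \<noteq> 0"
    using multiple_in_span_or_separated[of "int_vec ` A" x] assms(1) by blast
  have "span (logvec ` A) = UNIV"
    using assms(2) by (simp add: log_rank_def flip: dim_eq_full)
  moreover have "span (logvec ` A) \<subseteq> {u. inner (to_real c) u = 0}"
    using c(1) by (intro span_minimal subspace_hyperplane) (auto simp: inner_to_real simp flip: to_real_int_vec)
  ultimately have "inner (to_real c) (to_real x) = 0" by blast
  then show False using c(2) by (simp add: inner_to_real)
qed

lemma vdeg_span_dvd:
  assumes "\<forall>a\<in>A. expdeg a = d" "x \<in> zmod.span (int_vec ` A)"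
  shows "int d dvd vdeg x"
  using assms(2) by (induction rule: zmod.span_induct_alt) (use assms(1) in \<open>auto simp: vdeg_int_vec\<close>)

text \<open>
  Full rank puts a multiple of any integer point into the span. If \<open>d\<close> divides its degree, the point can
  be moved by an element \<open>f\<close> of the semigroup into the cone, where saturation applies.
\<close>

lemma normal_span_eq:
  assumes normal: "normal_ideal (ideal_of (xmonom ` A :: ('n::finite, 'k::field) mpoly set))"
    and deg: "\<forall>a\<in>A. expdeg a = d" and d: "d > 0"
    and rank: "finite A" "log_rank A = CARD('n)"
  shows "zmod.span (int_vec ` A) = {x. int d dvd vdeg x}"
proof
  show "zmod.span (int_vec ` A) \<subseteq> {x. int d dvd vdeg x}" using vdeg_span_dvd[OF deg] by blast
  show "{x. int d dvd vdeg x} \<subseteq> zmod.span (int_vec ` A)"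
  proof
    fix x :: "int ^ 'n" assume x: "x \<in> {x. int d dvd vdeg x}"
    obtain K where K: "K \<ge> 1" "K *s x \<in> zmod.span (int_vec ` A)"
      using full_rank_multiple_in_span[OF rank] by blast
    obtain f where f: "f \<in> nat_span (int_vec ` A)" "K *s x + f \<in> nat_span (int_vec ` A)"
      using span_plus_nat_span[OF K(2)] by blast
    have fs: "f \<in> zmod.span (int_vec ` A)" using f(1) by (rule nat_span_subset_span)
    have "(K *s x + f) + (K - 1) *s f \<in> nat_span (int_vec ` A)"
      using K(1) by (intro nat_span_add[OF f(2)] nat_span_scale[OF f(1)]) simp
    moreover have "(K *s x + f) + (K - 1) *s f = K *s (x + f)"
      by (simp add: vec_eq_iff algebra_simps)
    moreover have "int d dvd vdeg (x + f)" using x vdeg_span_dvd[OF deg fs] by simp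
    ultimately have "x + f \<in> nat_span (int_vec ` A)"
      using normal_nat_span_saturated[OF normal deg d] K(1) by metis
    then have "x + f - f \<in> zmod.span (int_vec ` A)"
      using nat_span_subset_span fs zmod.span_diff by blast
    then show "x \<in> zmod.span (int_vec ` A)" by simp
  qed
qed

section \<open>Monomial maps whose exponents form a lattice basis\<close>

definition exponent_comb :: "('n::finite \<Rightarrow>\<^sub>0 nat) \<Rightarrow> ('n \<Rightarrow> 'n \<Rightarrow>\<^sub>0 nat) \<Rightarrow> ('n \<Rightarrow>\<^sub>0 nat)" where
  "exponent_comb u w = (\<Sum>j\<in>UNIV. \<Sum>_<Poly_Mapping.lookup u j. w j)"

lemma psubst_xmonom:
  "psubst (\<lambda>i. xmonom (w i)) (xmonom u) = (xmonom (exponent_comb u w) :: ('n::finite, 'k::field) mpoly)"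
  unfolding psubst_def keys_xmonom by (simp add: xmonom_def[of u] exponent_comb_def xmonom_sum)

lemma int_vec_exponent_comb:
  "int_vec (exponent_comb u w) = (\<Sum>j\<in>UNIV. int (Poly_Mapping.lookup u j) *s int_vec (w j))"
  by (simp only: exponent_comb_def int_vec_sum sum_const_vec)

lemma expdeg_exponent_comb: "\<forall>j. expdeg (w j) = d \<Longrightarrow> expdeg (exponent_comb u w) = expdeg u * d"
  by (simp add: exponent_comb_def expdeg_def[of u] sum_distrib_right)

lemma rational_map_xmonom:
  assumes "\<forall>i. expdeg (w i) = d"
  shows "rational_map (\<lambda>i. xmonom (w i) :: ('n::finite, 'k::field) mpoly)"
proof -
  have "xmonom (w i) \<noteq> (0 :: ('n, 'k) mpoly)" for i
    using keys_xmonom[of "w i", where 'k = 'k] by (metis insert_not_empty keys_zero)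
  then show ?thesis using assms by (auto simp: rational_map_def homogeneous_def)
qed

lemma same_rational_map_xvar:
  assumes "\<And>i j. int_vec (a i) + axis j 1 = int_vec (a j) + axis i 1"
  shows "same_rational_map (\<lambda>i. xmonom (a i) :: ('n::finite, 'k::field) mpoly) xvar"
proof -
  have "a i + Poly_Mapping.single j 1 = a j + Poly_Mapping.single i 1" for i j
    using assms[of i j] by (metis int_vec_add int_vec_eq_iff int_vec_single)
  then show ?thesis by (simp add: same_rational_map_def xvar_def xmonom_mult)
qed

text \<open>
  The difference of two coordinate vectors has degree zero, hence is an integer combination of the
  exponents. The coefficients \<open>B i\<close> that express \<open>axis i 1 - axis i0 1\<close> become, after adding one
  constant \<open>b\<close> to all of them, the exponents \<open>u i\<close> of the inverse map; the constant only contributes a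
  factor common to all coordinates, which does not change a rational map. Substituting \<open>w\<close> into \<open>u\<close>
  gives the identity by construction. The other composite is handled by the linear map \<open>Phi\<close> with
  columns \<open>w j\<close>, which is injective by independence and under which the claim becomes symmetric in the
  two coordinates compared.
\<close>

lemma cremona_of_lattice_basis:
  fixes w :: "'n::finite \<Rightarrow> ('n \<Rightarrow>\<^sub>0 nat)"
  assumes deg: "\<forall>i. expdeg (w i) = d" and d: "d > 0"
    and indep: "\<And>u. (\<Sum>j\<in>UNIV. u j *s int_vec (w j)) = 0 \<Longrightarrow> \<forall>j. u j = 0"
    and span: "\<And>x. vdeg x = 0 \<Longrightarrow> \<exists>u. x = (\<Sum>j\<in>UNIV. u j *s int_vec (w j))"
  shows "defines_cremona TYPE('k::field) w"
proof -
  fix i0 :: 'n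
  have "\<exists>u. axis i 1 - axis i0 1 = (\<Sum>j\<in>UNIV. u j *s int_vec (w j))" for i
    by (rule span) simp
  then obtain B where B: "\<And>i. axis i 1 - axis i0 1 = (\<Sum>j\<in>UNIV. B i j *s int_vec (w j))" by metis
  define b where "b = (\<Sum>i\<in>UNIV. \<Sum>j\<in>UNIV. \<bar>B i j\<bar>)"
  have b: "B i j + b \<ge> 0" for i j
  proof -
    have "\<bar>B i j\<bar> \<le> (\<Sum>j\<in>UNIV. \<bar>B i j\<bar>)" by (rule member_le_sum) auto
    also have "\<dots> \<le> b" unfolding b_def by (rule member_le_sum) (auto intro: sum_nonneg)
    finally show ?thesis by linarith
  qed
  have "\<exists>a. int_vec a = (\<chi> j. B i j + b)" for i
    using nonneg_is_int_vec[of "\<chi> j. B i j + b"] b by (metis vec_lambda_beta)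
  then obtain u where u: "\<And>i. int_vec (u i) = (\<chi> j. B i j + b)" by metis
  have lu: "int (Poly_Mapping.lookup (u i) j) = B i j + b" for i j
    using u[of i] by (simp add: int_vec_def vec_eq_iff)
  \<comment> \<open>Comparing degrees; this makes all the \<open>u i\<close> exponents of one degree.\<close>
  have "(\<Sum>j\<in>UNIV. B i j) = 0" for i
  proof -
    have "vdeg (axis i 1 - axis i0 1 :: int ^ 'n) = (\<Sum>j\<in>UNIV. B i j * int d)"
      unfolding B by (simp add: dotp_sum vdeg_int_vec deg)
    moreover have "vdeg (axis i 1 - axis i0 1 :: int ^ 'n) = 0"
      by simp
    ultimately show ?thesis using d by (simp flip: sum_distrib_right)
  qed
  then have "int (expdeg (u i)) = int CARD('n) * b" for i
    by (simp add: expdeg_def lu sum.distrib)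
  then have deg_u: "\<forall>i. expdeg (u i) = expdeg (u i0)" by (metis of_nat_eq_iff)
  define sig where "sig = (\<Sum>j\<in>UNIV. b *s int_vec (w j))"
  define Phi where "Phi x = (\<Sum>j\<in>UNIV. (x $ j) *s int_vec (w j))" for x
  have Phi_add: "Phi (x + y) = Phi x + Phi y" for x y
    by (simp add: Phi_def zmod.scale_left_distrib sum.distrib)
  have Phi_diff: "Phi (x - y) = Phi x - Phi y" for x y
    by (simp add: Phi_def zmod.scale_left_diff_distrib sum_subtractf)
  have Phi_scale: "Phi (k *s x) = k *s Phi x" for k x
    by (simp add: Phi_def zmod.scale_sum_right)
  have Phi_0: "Phi 0 = 0" by (simp add: Phi_def)
  have Phi_sum: "Phi (sum f UNIV) = (\<Sum>i\<in>UNIV. Phi (f i))" for f :: "'n \<Rightarrow> _"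
    by (rule sum_comp_morphism[unfolded comp_def, symmetric]) (auto simp: Phi_0 Phi_add)
  have Phi_axis: "Phi (axis i 1) = int_vec (w i)" for i
  proof -
    have "Phi (axis i 1) = (\<Sum>j\<in>UNIV. if j = i then int_vec (w j) else 0)"
      unfolding Phi_def by (intro sum.cong) (auto simp: axis_def)
    then show ?thesis by simp
  qed
  have Phi_inj: "x = y" if "Phi x = Phi y" for x y
    using indep[of "\<lambda>j. (x - y) $ j"] that Phi_diff[of x y] by (simp add: Phi_def vec_eq_iff)
  have Phi_u: "Phi (int_vec (u i)) = axis i 1 - axis i0 1 + sig" for i
    unfolding B by (simp add: Phi_def u sig_def zmod.scale_left_distrib sum.distrib)
  have gf: "int_vec (exponent_comb (u i) w) = axis i 1 - axis i0 1 + sig" for i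
    unfolding int_vec_exponent_comb Phi_u[symmetric] by (simp add: Phi_def int_vec_def)
  have fg: "int_vec (exponent_comb (w i) u) + axis j 1 = int_vec (exponent_comb (w j) u) + axis i 1" for i j
  proof (rule Phi_inj)
    have "Phi (int_vec (exponent_comb (w i) u)) = int_vec (w i) + int d *s (sig - axis i0 1)" for i
    proof -
      have "Phi (int_vec (exponent_comb (w i) u)) = (\<Sum>l\<in>UNIV. (int_vec (w i) $ l) *s Phi (int_vec (u l)))"
        by (simp add: int_vec_exponent_comb Phi_sum Phi_scale int_vec_def[of "w i"])
      also have "\<dots> = (\<Sum>l\<in>UNIV. (int_vec (w i) $ l) *s (axis l 1 + (sig - axis i0 1)))"
        unfolding Phi_u by (simp add: algebra_simps)
      also have "\<dots> = (\<Sum>l\<in>UNIV. (int_vec (w i) $ l) *s axis l 1)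
          + (\<Sum>l\<in>UNIV. int_vec (w i) $ l) *s (sig - axis i0 1)"
        by (simp only: zmod.scale_right_distrib sum.distrib zmod.scale_sum_left)
      also have "(\<Sum>l\<in>UNIV. (int_vec (w i) $ l) *s axis l 1) = int_vec (w i)"
        by (rule basis_expansion)
      also have "(\<Sum>l\<in>UNIV. int_vec (w i) $ l) = int d"
        using deg vdeg_int_vec[of "w i"] by (simp add: dotp_def)
      finally show ?thesis .
    qed
    then show "Phi (int_vec (exponent_comb (w i) u) + axis j 1) = Phi (int_vec (exponent_comb (w j) u) + axis i 1)"
      by (simp add: Phi_add Phi_axis)
  qed
  let ?f = "\<lambda>i. xmonom (w i) :: ('n, 'k) mpoly"
  let ?g = "\<lambda>i. xmonom (u i) :: ('n, 'k) mpoly"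
  have comp: "rational_comp ?g ?f = (\<lambda>i. xmonom (exponent_comb (u i) w))"
    "rational_comp ?f ?g = (\<lambda>i. xmonom (exponent_comb (w i) u))"
    by (simp_all add: rational_comp_def psubst_xmonom)
  have "birational ?f"
    unfolding birational_def
  proof (intro conjI exI[of _ ?g])
    show "rational_map ?f" "rational_map ?g" using deg deg_u by (auto intro: rational_map_xmonom)
    show "rational_map (rational_comp ?g ?f)" unfolding comp
      by (rule rational_map_xmonom[where d = "expdeg (u i0) * d"])
         (use expdeg_exponent_comb[OF deg] deg_u in metis)
    show "rational_map (rational_comp ?f ?g)" unfolding comp
      by (rule rational_map_xmonom[where d = "d * expdeg (u i0)"])
         (use expdeg_exponent_comb[OF deg_u] deg in metis)
    show "same_rational_map (rational_comp ?g ?f) xvar" unfolding comp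
      by (rule same_rational_map_xvar) (simp add: gf)
    show "same_rational_map (rational_comp ?f ?g) xvar" unfolding comp
      by (rule same_rational_map_xvar) (rule fg)
  qed
  then show ?thesis unfolding defines_cremona_def using deg by (intro conjI exI[of _ d])
qed

section \<open>Normal monomial ideals and Cremona transformations\<close>

theorem theorem3p9:
  fixes v :: "nat \<Rightarrow> ('n::{finite,linorder} \<Rightarrow>\<^sub>0 nat)" and q d :: nat
  assumes n_ge_2: "CARD('n) \<ge> 2"
    and q_ge_n: "q \<ge> CARD('n)"
    and same_degree: "\<forall>j\<in>{1..q}. expdeg (v j) = d"
    and full_rank: "log_rank (v ` {1..q}) = CARD('n)"
    and normal: "normal_ideal (ideal_of ((\<lambda>j. xmonom (v j) :: ('n, 'k::field) mpoly) ` {1..q}))"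
  shows "\<exists>s :: 'n \<Rightarrow> nat. inj s \<and> range s \<subseteq> {1..q} \<and> defines_cremona TYPE('k) (\<lambda>i. v (s i))"
proof -
  define A where "A = v ` {1..q}"
  define S where "S = int_vec ` A"
  have A: "finite A" "\<forall>a\<in>A. expdeg a = d" "log_rank A = CARD('n)"
  proof -
    show "finite A" by (simp add: A_def)
    show "\<forall>a\<in>A. expdeg a = d" unfolding A_def using same_degree by blast
    show "log_rank A = CARD('n)" unfolding A_def by (rule full_rank)
  qed
  have normal_A: "normal_ideal (ideal_of (xmonom ` A :: ('n, 'k) mpoly set))"
    using normal by (simp only: A_def image_image)
  have d: "d > 0"
  proof (rule ccontr)
    assume "\<not> d > 0"
    then have "A \<subseteq> {0}" using A(2) by auto
    then have "logvec ` A \<subseteq> {0}" by (auto simp: logvec_def vec_eq_iff)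
    then have "log_rank A = 0" unfolding log_rank_def by simp
    then show False using A(3) by simp
  qed
  have S_span: "zmod.span S = {x. int d dvd vdeg x}"
    unfolding S_def using normal_span_eq[OF normal_A A(2) d A(1,3)] .
  have "is_hilbert_basis S"
    unfolding is_hilbert_basis_def S_span unfolding S_def
    using normal_nat_span_saturated[OF normal_A A(2) d] by blast
  moreover have fin: "finite S" using A(1) by (simp add: S_def)
  moreover have "\<forall>s\<in>S. vdeg s > 0" using A(2) d by (simp add: S_def vdeg_int_vec)
  ultimately obtain W where W: "W \<subseteq> S" "zmod.span W = zmod.span S" "inj_on to_real W"
      "independent (to_real ` W)"
    using hilbert_basis_contains_lattice_basis by blast
  have finW: "finite W" using finite_subset[OF W(1) fin] .
  have "span (to_real ` W) = UNIV"
  proof -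
    have "logvec ` A \<subseteq> span (to_real ` W)"
    proof (intro subsetI, elim imageE)
      fix x a assume a: "x = logvec a" "a \<in> A"
      then have "int_vec a \<in> zmod.span W" unfolding W(2) S_def by (intro zmod.span_base imageI)
      then show "x \<in> span (to_real ` W)" using to_real_span a(1) to_real_int_vec by metis
    qed
    then have "span (logvec ` A) \<subseteq> span (to_real ` W)" by (simp add: span_minimal)
    moreover have "span (logvec ` A) = UNIV"
      using A(3) by (simp add: log_rank_def flip: dim_eq_full)
    ultimately show ?thesis by blast
  qed
  then have "dim (to_real ` W) = CARD('n)" by (simp flip: dim_eq_full)
  then have "card (to_real ` W) = CARD('n)" using dim_eq_card_independent[OF W(4)] by simp
  then have "card W = CARD('n)" using W(3) by (simp add: card_image)
  then obtain \<beta> where \<beta>: "bij_betw \<beta> (UNIV :: 'n set) W"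
    using finite_same_card_bij[OF finite_class.finite_UNIV finW] by metis
  have "\<exists>j\<in>{1..q}. int_vec (v j) = \<beta> i" for i
  proof -
    have "\<beta> i \<in> S" using \<beta> W(1) by (auto simp: bij_betw_def)
    then show ?thesis by (auto simp: S_def A_def)
  qed
  then obtain s where s: "\<And>i. s i \<in> {1..q}" "\<And>i. int_vec (v (s i)) = \<beta> i" by metis
  have inj_\<beta>: "inj \<beta>" and ran_\<beta>: "range \<beta> = W" using \<beta> by (auto simp: bij_betw_def)
  have "inj s" by (rule injI) (metis s(2) inj_\<beta> injD)
  moreover have "defines_cremona TYPE('k) (\<lambda>i. v (s i))"
  proof (rule cremona_of_lattice_basis[where d = d])
    show "\<forall>i. expdeg (v (s i)) = d" using s(1) same_degree by blast
    show "d > 0" by (rule d)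
  next
    fix u assume "(\<Sum>j\<in>UNIV. u j *s int_vec (v (s j))) = 0"
    then have "to_real (\<Sum>j\<in>UNIV. u j *s \<beta> j) = 0" by (simp add: s(2))
    then have "(\<Sum>j\<in>UNIV. real_of_int (u j) *\<^sub>R to_real (\<beta> j)) = 0" by (simp add: to_real_sum)
    moreover define \<gamma> where "\<gamma> = (\<lambda>j. to_real (\<beta> j))"
    ultimately have sum0: "(\<Sum>j\<in>UNIV. real_of_int (u j) *\<^sub>R \<gamma> j) = 0" by simp
    have inj_\<gamma>: "inj \<gamma>" using comp_inj_on[OF inj_\<beta>] W(3) unfolding ran_\<beta>[symmetric] \<gamma>_def comp_def .
    have "(\<Sum>y\<in>range \<gamma>. real_of_int (u (inv \<gamma> y)) *\<^sub>R y) = 0"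
      using sum0 by (simp add: sum.reindex[OF inj_\<gamma>] inv_f_f[OF inj_\<gamma>])
    moreover have "range \<gamma> = to_real ` W" using ran_\<beta> by (auto simp: \<gamma>_def)
    ultimately have "real_of_int (u (inv \<gamma> (\<gamma> j))) = 0" for j
      by (intro independentD[OF W(4), where t = "range \<gamma>"]) (use finW in auto)
    then show "\<forall>j. u j = 0" by (simp add: inv_f_f[OF inj_\<gamma>])
  next
    fix x :: "(int, 'n) vec" assume "vdeg x = 0"
    then have "x \<in> zmod.span W" using S_span W(2) by simp
    then obtain u where "x = (\<Sum>y\<in>W. u y *s y)" using zmod.span_finite[OF finW] by auto
    also have "\<dots> = (\<Sum>j\<in>UNIV. u (\<beta> j) *s \<beta> j)"
      using sum.reindex[OF inj_\<beta>, of "\<lambda>y. u y *s y"] ran_\<beta> by simp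
    finally have "x = (\<Sum>j\<in>UNIV. u (\<beta> j) *s int_vec (v (s j)))" by (simp add: s(2))
    then show "\<exists>u. x = (\<Sum>j\<in>UNIV. u j *s int_vec (v (s j)))" by (intro exI[of _ "\<lambda>j. u (\<beta> j)"])
  qed
  ultimately show ?thesis using s(1) by blast
qed

end
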